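(* Let $(\mathfrak a,[\cdot,\cdot]_{\mathfrak a},\omega_{\mathfrak a})$ be a symplectic Lie algebra, $(\mathcal B,[\cdot,\cdot]_{\mathcal B})$ a Lie algebra, $\rho_1:\mathfrak a\to\mathfrak{gl}(\mathcal B^* )$ a representation, $\psi\in\mathcal Z^2(\mathfrak a,\rho_1)$, $\pi_1:\mathfrak a\to\mathfrak{gl}(\mathcal B)$, $\pi_2:\mathcal B\to\mathfrak{gl}(\mathfrak a)$, $\rho_2:\mathcal B\to\mathfrak{gl}(\mathcal B^* )$ linear maps, $\Phi_1:\mathcal B\times\mathcal B\to\mathfrak a$, $\Phi_2:\mathcal B\times\mathcal B\to\mathcal B^*$ skew-symmetric bilinear maps and $\Omega:\mathcal B\times\mathfrak a\to\mathcal B^*$ a bilinear map. Suppose that $\mathfrak g=\mathcal B\oplus\mathfrak a\oplus\mathcal B^*$ with the skew-symmetric bracket $[b_1,b_2]=[b_1,b_2]_{\mathcal B}+\Phi_1(b_1,b_2)+\Phi_2(b_1,b_2)$, $[a_1,a_2]=[a_1,a_2]_{\mathfrak a}+\psi(a_1,a_2)$, $[a,f]=\rho_1(a)(f)$, $[b,f]=\rho_2(b)(f)$, $[b,a]=-\pi_1(a)(b)+\pi_2(b)(a)+\Omega(b,a)$, $[\mathcal B^*,\mathcal B^*]=0$ ($a,a_i\in\mathfrak a$, $b,b_i\in\mathcal B$, $f\in\mathcal B^*$) is a Lie algebra. Then the nondegenerate skew-symmetric bilinear form $$\omega(b_1+a_1+f_1,b_2+a_2+f_2):=\omega_{\mathfrak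 a}(a_1,a_2)-f_1(b_2)+f_2(b_1)$$ is a $2$-cocycle of $(\mathfrak g,[\cdot,\cdot])$ if and only if the following five conditions hold for all $a,a_1,a_2\in\mathfrak a$, $b,b_1,b_2,b_3\in\mathcal B$, $f\in\mathcal B^*$: (C1') $\rho_1(a)(f)(b)=-f(\pi_1(a)(b))$; (C2') $\Phi_2(b_1,b_2)(b_3)+\Phi_2(b_2,b_3)(b_1)+\Phi_2(b_3,b_1)(b_2)=0$; (C3') $\Omega(b_1,a)(b_2)-\Omega(b_2,a)(b_1)=\omega_{\mathfrak a}(a,\Phi_1(b_1,b_2))$; (C4') $f([b_1,b_2]_{\mathcal B})=\rho_2(b_2)(f)(b_1)-\rho_2(b_1)(f)(b_2)$; (C5') $\psi(a_1,a_2)(b)=\omega_{\mathfrak a}(\pi_2(b)(a_1),a_2)+\omega_{\mathfrak a}(a_1,\pi_2(b)(a_2))$.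
   Context: All Lie algebras are real and finite-dimensional. A $2$-cocycle of a Lie algebra $\mathfrak g$ (trivial real coefficients) is a skew-symmetric bilinear form $\omega$ with $\omega([x,y],z)+\omega([y,z],x)+\omega([z,x],y)=0$ for all $x,y,z$. A symplectic Lie algebra is a Lie algebra with a nondegenerate $2$-cocycle. For a representation $\rho_1$ of $\mathfrak a$ on $V$, $\mathcal Z^2(\mathfrak a,\rho_1)$ is the space of skew-symmetric bilinear maps $\psi:\mathfrak a\times\mathfrak a\to V$ with $\sum_{\circlearrowright(x,y,z)}\big(\rho_1(x)(\psi(y,z))+\psi(x,[y,z]_{\mathfrak a})\big)=0$ (cyclic sum). *)

theory Defs
  imports "HOL-Analysis.Analysis"
begin

text \<open>
  The vector spaces are types of class \<^class>\<open>real_vector\<close>, with finite dimension as an explicit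
  condition; the class \<open>euclidean_space\<close> would exclude the zero space.
\<close>

definition finite_dimensional :: "'a::real_vector itself \<Rightarrow> bool" where
  "finite_dimensional _ \<longleftrightarrow> (\<exists>S :: 'a set. finite S \<and> span S = UNIV)"

text \<open>The full linear dual; no norm or topology is involved.\<close>

typedef (overloaded) 'a dual = "{f :: 'a::real_vector \<Rightarrow> real. linear f}"
  morphisms dual_apply Dual
  by (rule exI[of _ "\<lambda>_. 0"]) (simp add: linear_iff)

setup_lifting type_definition_dual

instantiation dual :: (real_vector) real_vector
begin

lift_definition zero_dual :: "'a dual" is "\<lambda>_. 0"
  by (simp add: linear_iff)

lift_definition uminus_dual :: "'a dual \<Rightarrow> 'a dual" is "\<lambda>f x. - f x"
  by (simp add: linear_iff)

lift_definition plus_dual :: "'a dual \<Rightarrow> 'a dual \<Rightarrow> 'a dual" is "\<lambda>f g x. f x + g x"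
  by (simp add: linear_iff algebra_simps)

lift_definition minus_dual :: "'a dual \<Rightarrow> 'a dual \<Rightarrow> 'a dual" is "\<lambda>f g x. f x - g x"
  by (simp add: linear_iff algebra_simps)

lift_definition scaleR_dual :: "real \<Rightarrow> 'a dual \<Rightarrow> 'a dual" is "\<lambda>c f x. c * f x"
  by (simp add: linear_iff algebra_simps)

instance
  by standard (transfer; simp add: fun_eq_iff algebra_simps)+

end

lemma linear_dual_apply: "linear (dual_apply f)"
  using dual_apply[of f] by simp

definition skew_symmetric :: "('a \<Rightarrow> 'a \<Rightarrow> 'b::real_vector) \<Rightarrow> bool" where
  "skew_symmetric \<phi> \<longleftrightarrow> (\<forall>x y. \<phi> x y = - \<phi> y x)"

definition nondegenerate :: "('a::real_vector \<Rightarrow> 'a \<Rightarrow> real) \<Rightarrow> bool" where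
  "nondegenerate \<omega> \<longleftrightarrow> (\<forall>x. (\<forall>y. \<omega> x y = 0) \<longrightarrow> x = 0)"

definition lie_algebra :: "('a::real_vector \<Rightarrow> 'a \<Rightarrow> 'a) \<Rightarrow> bool" where
  "lie_algebra br \<longleftrightarrow>
     finite_dimensional TYPE('a) \<and> bilinear br \<and> skew_symmetric br \<and>
     (\<forall>x y z. br x (br y z) + br y (br z x) + br z (br x y) = 0)"

definition two_cocycle ::
  "('a::real_vector \<Rightarrow> 'a \<Rightarrow> 'a) \<Rightarrow> ('a \<Rightarrow> 'a \<Rightarrow> real) \<Rightarrow> bool" where
  "two_cocycle br \<omega> \<longleftrightarrow>
     bilinear \<omega> \<and> skew_symmetric \<omega> \<and>
     (\<forall>x y z. \<omega> (br x y) z + \<omega> (br y z) x + \<omega> (br z x) y = 0)"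

definition symplectic_lie_algebra ::
  "('a::real_vector \<Rightarrow> 'a \<Rightarrow> 'a) \<Rightarrow> ('a \<Rightarrow> 'a \<Rightarrow> real) \<Rightarrow> bool" where
  "symplectic_lie_algebra br \<omega> \<longleftrightarrow>
     lie_algebra br \<and> two_cocycle br \<omega> \<and> nondegenerate \<omega>"

text \<open>
  A linear map \<open>V \<rightarrow> gl(W)\<close> is given in curried form; it is linear with linear values
  exactly if it is \<^const>\<open>bilinear\<close>.
\<close>

definition lie_representation ::
  "('a::real_vector \<Rightarrow> 'a \<Rightarrow> 'a) \<Rightarrow> ('a \<Rightarrow> 'v::real_vector \<Rightarrow> 'v) \<Rightarrow> bool" where
  "lie_representation br \<rho> \<longleftrightarrow>
     bilinear \<rho> \<and> (\<forall>x y v. \<rho> (br x y) v = \<rho> x (\<rho> y v) - \<rho> y (\<rho> x v))"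

definition Z2 ::
  "('a::real_vector \<Rightarrow> 'a \<Rightarrow> 'a) \<Rightarrow> ('a \<Rightarrow> 'v::real_vector \<Rightarrow> 'v) \<Rightarrow> ('a \<Rightarrow> 'a \<Rightarrow> 'v) set" where
  "Z2 br \<rho> = {\<psi>. bilinear \<psi> \<and> skew_symmetric \<psi> \<and>
     (\<forall>x y z. (\<rho> x (\<psi> y z) + \<psi> x (br y z)) + (\<rho> y (\<psi> z x) + \<psi> y (br z x))
            + (\<rho> z (\<psi> x y) + \<psi> z (br x y)) = 0)}"

text \<open>The triple \<open>(b, a, f)\<close> stands for \<open>b + a + f\<close> in \<open>\<B> \<oplus> \<aa> \<oplus> \<B>\<^sup>*\<close>.\<close>

definition extension_form ::
  "('a \<Rightarrow> 'a \<Rightarrow> real) \<Rightarrow>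
   'b::real_vector \<times> 'a::real_vector \<times> 'b dual \<Rightarrow> 'b \<times> 'a \<times> 'b dual \<Rightarrow> real" where
  "extension_form \<omega>a = (\<lambda>(b1, a1, f1) (b2, a2, f2).
     \<omega>a a1 a2 - dual_apply f1 b2 + dual_apply f2 b1)"

end

theory Submission
  imports Defs
begin

text \<open>
  The cyclic sum \<open>J(x, y, z) = \<omega>([x, y], z) + \<omega>([y, z], x) + \<omega>([z, x], y)\<close> is trilinear and
  alternating, so it vanishes identically iff it vanishes whenever each argument lies in one of
  the three summands \<open>\<B>\<close>, \<open>\<aa>\<close>, \<open>\<B>\<^sup>*\<close>. Up to the order of the arguments there are ten types of
  triples. The type \<open>(\<aa>, \<aa>, \<aa>)\<close> contributes the cyclic sum of \<open>\<omega>\<^sub>\<aa>\<close>, which is zero. The types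
  \<open>(\<aa>, \<aa>, \<B>\<^sup>*)\<close>, \<open>(\<aa>, \<B>\<^sup>*, \<B>\<^sup>*)\<close>, \<open>(\<B>\<^sup>*, \<B>\<^sup>*, \<B>\<^sup>*)\<close> contribute nothing: \<open>\<aa> \<oplus> \<B>\<^sup>*\<close> is closed under the
  bracket, brackets with an element of \<open>\<B>\<^sup>*\<close> stay in \<open>\<B>\<^sup>*\<close>, and \<open>\<omega>\<close> pairs \<open>\<B>\<^sup>*\<close> only with \<open>\<B>\<close>. The
  type \<open>(\<B>, \<B>\<^sup>*, \<B>\<^sup>*)\<close> vanishes since \<open>\<B>\<^sup>*\<close> is an abelian ideal and isotropic for \<open>\<omega>\<close>. The remaining
  five types \<open>(\<B>, \<aa>, \<B>\<^sup>*)\<close>, \<open>(\<B>, \<B>, \<B>)\<close>, \<open>(\<B>, \<B>, \<aa>)\<close>, \<open>(\<B>, \<B>, \<B>\<^sup>*)\<close>, \<open>(\<aa>, \<aa>, \<B>)\<close> give the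
  five conditions, in this order.

  The decomposition of \<open>J\<close> is carried out as one explicit identity, in which the differences
  \<open>D1\<close> to \<open>D5\<close> of the two sides of the conditions are, up to sign, the components of \<open>J\<close>. For the form
  itself, nondegeneracy on \<open>\<B> \<oplus> \<B>\<^sup>*\<close> is the fact that linear functionals separate points.
\<close>

lemmas dual_apply_simps =
  zero_dual.rep_eq uminus_dual.rep_eq plus_dual.rep_eq minus_dual.rep_eq scaleR_dual.rep_eq
  linear_0[OF linear_dual_apply] linear_add[OF linear_dual_apply]
  linear_diff[OF linear_dual_apply] linear_neg[OF linear_dual_apply]
  linear_scale[OF linear_dual_apply]

lemmas bilinear_simps =
  bilinear_ladd bilinear_radd bilinear_lsub bilinear_rsub bilinear_lneg bilinear_rneg
  bilinear_lmul bilinear_rmul bilinear_lzero bilinear_rzero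

lemma dual_separates_points:
  fixes b :: "'b::real_vector"
  assumes "\<And>f :: 'b dual. dual_apply f b = 0"
  shows "b = 0"
proof (rule ccontr)
  assume "b \<noteq> 0"
  then have "independent {b}"
    by simp
  then obtain g :: "'b \<Rightarrow> real" where g: "linear g" "\<forall>x\<in>{b}. g x = 1"
    using linear_independent_extend[of "{b}" "\<lambda>_. 1"] by blast
  then have "dual_apply (Dual g) b = 1"
    by (simp add: Dual_inverse)
  then show False
    using assms by simp
qed

lemma bilinear_extension_form:
  assumes "bilinear \<omega>"
  shows "bilinear (extension_form \<omega>)"
  unfolding bilinear_def linear_iff extension_form_def
  by (auto simp: dual_apply_simps bilinear_simps[OF assms] algebra_simps)

lemma skew_symmetric_extension_form:
  fixes \<omega> :: "'a::real_vector \<Rightarrow> 'a \<Rightarrow> real"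
  assumes "skew_symmetric \<omega>"
  shows "skew_symmetric (extension_form \<omega> :: 'b::real_vector \<times> 'a \<times> 'b dual \<Rightarrow> _)"
  unfolding skew_symmetric_def
proof (intro allI)
  fix x y :: "'b \<times> 'a \<times> 'b dual"
  have "\<omega> (fst (snd x)) (fst (snd y)) = - \<omega> (fst (snd y)) (fst (snd x))"
    using assms unfolding skew_symmetric_def by blast
  then show "extension_form \<omega> x y = - extension_form \<omega> y x"
    by (simp add: extension_form_def split_beta)
qed

lemma nondegenerate_extension_form:
  assumes "bilinear \<omega>" and "nondegenerate \<omega>"
  shows "nondegenerate (extension_form \<omega>)"
  unfolding nondegenerate_def
proof (intro allI impI)
  fix x
  assume orth: "\<forall>y. extension_form \<omega> x y = 0"
  obtain b a f where x: "x = (b, a, f)"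
    by (cases x)
  note simps = x extension_form_def dual_apply_simps bilinear_simps[OF assms(1)]
  have "\<omega> a a' = 0" for a'
    using orth[rule_format, of "(0, a', 0)"] by (simp add: simps)
  then have "a = 0"
    using assms(2) unfolding nondegenerate_def by blast
  moreover have "dual_apply f b' = 0" for b'
    using orth[rule_format, of "(b', 0, 0)"] by (simp add: simps)
  then have "f = 0"
    by (simp add: dual_apply_inject[symmetric] zero_dual.rep_eq fun_eq_iff)
  moreover have "dual_apply f' b = 0" for f'
    using orth[rule_format, of "(0, 0, f')"] by (simp add: simps)
  then have "b = 0"
    by (rule dual_separates_points)
  ultimately show "x = 0"
    by (simp add: x zero_prod_def)
qed

text \<open>
  A skew-symmetric bilinear bracket on \<open>\<B> \<oplus> \<aa> \<oplus> \<B>\<^sup>*\<close> is determined by its values on pairs of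
  elements of the summands, taken in one order.
\<close>

lemma extension_bracket_expand:
  fixes br :: "'b::real_vector \<times> 'a::real_vector \<times> 'c::real_vector \<Rightarrow> _"
  assumes bil: "bilinear br" and skew: "skew_symmetric br"
    and BB: "\<And>b1 b2. br (b1, 0, 0) (b2, 0, 0) = (brB b1 b2, \<Phi>1 b1 b2, \<Phi>2 b1 b2)"
    and AA: "\<And>a1 a2. br (0, a1, 0) (0, a2, 0) = (0, bra a1 a2, \<psi> a1 a2)"
    and AF: "\<And>a f. br (0, a, 0) (0, 0, f) = (0, 0, \<rho>1 a f)"
    and BF: "\<And>b f. br (b, 0, 0) (0, 0, f) = (0, 0, \<rho>2 b f)"
    and BA: "\<And>b a. br (b, 0, 0) (0, a, 0) = (- \<pi>1 a b, \<pi>2 b a, \<Omega> b a)"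
    and FF: "\<And>f1 f2. br (0, 0, f1) (0, 0, f2) = 0"
  shows "br (b1, a1, f1) (b2, a2, f2) =
    (brB b1 b2 - \<pi>1 a2 b1 + \<pi>1 a1 b2,
     \<Phi>1 b1 b2 + bra a1 a2 + \<pi>2 b1 a2 - \<pi>2 b2 a1,
     \<Phi>2 b1 b2 + \<psi> a1 a2 + \<rho>1 a1 f2 - \<rho>1 a2 f1 + \<rho>2 b1 f2 - \<rho>2 b2 f1 + \<Omega> b1 a2 - \<Omega> b2 a1)"
proof -
  have flip: "br x y = - br y x" for x y
    using skew unfolding skew_symmetric_def by blast
  have split: "(b, a, f) = (b, 0, 0) + (0, a, 0) + (0, 0, f)" for b :: 'b and a :: 'a and f :: 'c
    by simp
  have "br (b1, a1, f1) (b2, a2, f2) =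
      br ((b1, 0, 0) + (0, a1, 0) + (0, 0, f1)) ((b2, 0, 0) + (0, a2, 0) + (0, 0, f2))"
    by simp
  also have "\<dots> =
      br (b1, 0, 0) (b2, 0, 0) + br (b1, 0, 0) (0, a2, 0) + br (b1, 0, 0) (0, 0, f2)
      - br (b2, 0, 0) (0, a1, 0) + br (0, a1, 0) (0, a2, 0) + br (0, a1, 0) (0, 0, f2)
      - br (b2, 0, 0) (0, 0, f1) - br (0, a2, 0) (0, 0, f1) + br (0, 0, f1) (0, 0, f2)"
    unfolding bilinear_ladd[OF bil] bilinear_radd[OF bil]
    unfolding flip[of "(0, a1, 0)" "(b2, 0, 0)"] flip[of "(0, 0, f1)" "(b2, 0, 0)"]
      flip[of "(0, 0, f1)" "(0, a2, 0)"]
    by (simp only: diff_conv_add_uminus ac_simps)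
  also have "\<dots> = (brB b1 b2 - \<pi>1 a2 b1 + \<pi>1 a1 b2,
     \<Phi>1 b1 b2 + bra a1 a2 + \<pi>2 b1 a2 - \<pi>2 b2 a1,
     \<Phi>2 b1 b2 + \<psi> a1 a2 + \<rho>1 a1 f2 - \<rho>1 a2 f1 + \<rho>2 b1 f2 - \<rho>2 b2 f1 + \<Omega> b1 a2 - \<Omega> b2 a1)"
    unfolding BB AA AF BF BA FF by simp
  finally show ?thesis .
qed

theorem proposition2p3:
  fixes bra :: "'a::real_vector \<Rightarrow> 'a \<Rightarrow> 'a"
    and \<omega>a :: "'a \<Rightarrow> 'a \<Rightarrow> real"
    and brB :: "'b::real_vector \<Rightarrow> 'b \<Rightarrow> 'b"
    and \<rho>1 :: "'a \<Rightarrow> 'b dual \<Rightarrow> 'b dual"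
    and \<psi> :: "'a \<Rightarrow> 'a \<Rightarrow> 'b dual"
    and \<pi>1 :: "'a \<Rightarrow> 'b \<Rightarrow> 'b"
    and \<pi>2 :: "'b \<Rightarrow> 'a \<Rightarrow> 'a"
    and \<rho>2 :: "'b \<Rightarrow> 'b dual \<Rightarrow> 'b dual"
    and \<Phi>1 :: "'b \<Rightarrow> 'b \<Rightarrow> 'a"
    and \<Phi>2 :: "'b \<Rightarrow> 'b \<Rightarrow> 'b dual"
    and \<Omega> :: "'b \<Rightarrow> 'a \<Rightarrow> 'b dual"
    and br :: "'b \<times> 'a \<times> 'b dual \<Rightarrow> 'b \<times> 'a \<times> 'b dual \<Rightarrow> 'b \<times> 'a \<times> 'b dual"
  assumes "symplectic_lie_algebra bra \<omega>a"
    and "lie_algebra brB"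
    and "lie_representation bra \<rho>1"
    and "\<psi> \<in> Z2 bra \<rho>1"
    and "bilinear \<pi>1" and "bilinear \<pi>2" and "bilinear \<rho>2"
    and "bilinear \<Phi>1" and "skew_symmetric \<Phi>1"
    and "bilinear \<Phi>2" and "skew_symmetric \<Phi>2"
    and "bilinear \<Omega>"
    and "lie_algebra br"
    and "\<And>b1 b2. br (b1, 0, 0) (b2, 0, 0) = (brB b1 b2, \<Phi>1 b1 b2, \<Phi>2 b1 b2)"
    and "\<And>a1 a2. br (0, a1, 0) (0, a2, 0) = (0, bra a1 a2, \<psi> a1 a2)"
    and "\<And>a f. br (0, a, 0) (0, 0, f) = (0, 0, \<rho>1 a f)"
    and "\<And>b f. br (b, 0, 0) (0, 0, f) = (0, 0, \<rho>2 b f)"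
    and "\<And>b a. br (b, 0, 0) (0, a, 0) = (- \<pi>1 a b, \<pi>2 b a, \<Omega> b a)"
    and "\<And>f1 f2. br (0, 0, f1) (0, 0, f2) = 0"
  shows "bilinear (extension_form \<omega>a :: 'b \<times> 'a \<times> 'b dual \<Rightarrow> 'b \<times> 'a \<times> 'b dual \<Rightarrow> real)
    \<and> skew_symmetric (extension_form \<omega>a :: 'b \<times> 'a \<times> 'b dual \<Rightarrow> 'b \<times> 'a \<times> 'b dual \<Rightarrow> real)
    \<and> nondegenerate (extension_form \<omega>a :: 'b \<times> 'a \<times> 'b dual \<Rightarrow> 'b \<times> 'a \<times> 'b dual \<Rightarrow> real)
    \<and> (two_cocycle br (extension_form \<omega>a) \<longleftrightarrow>
        (\<forall>a f b. dual_apply (\<rho>1 a f) b = - dual_apply f (\<pi>1 a b))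
      \<and> (\<forall>b1 b2 b3. dual_apply (\<Phi>2 b1 b2) b3 + dual_apply (\<Phi>2 b2 b3) b1
                     + dual_apply (\<Phi>2 b3 b1) b2 = 0)
      \<and> (\<forall>a b1 b2. dual_apply (\<Omega> b1 a) b2 - dual_apply (\<Omega> b2 a) b1 = \<omega>a a (\<Phi>1 b1 b2))
      \<and> (\<forall>f b1 b2. dual_apply f (brB b1 b2)
                     = dual_apply (\<rho>2 b2 f) b1 - dual_apply (\<rho>2 b1 f) b2)
      \<and> (\<forall>a1 a2 b. dual_apply (\<psi> a1 a2) b = \<omega>a (\<pi>2 b a1) a2 + \<omega>a a1 (\<pi>2 b a2)))"
proof -
  let ?\<omega> = "extension_form \<omega>a :: 'b \<times> 'a \<times> 'b dual \<Rightarrow> 'b \<times> 'a \<times> 'b dual \<Rightarrow> real"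
  have \<omega>a: "bilinear \<omega>a" "skew_symmetric \<omega>a" "nondegenerate \<omega>a"
    and closed: "\<omega>a (bra x y) z + \<omega>a (bra y z) x + \<omega>a (bra z x) y = 0" for x y z
    using assms(1) unfolding symplectic_lie_algebra_def two_cocycle_def by blast+
  have flip: "\<omega>a x y = - \<omega>a y x" for x y
    using \<omega>a(2) unfolding skew_symmetric_def by blast
  have bil: "bilinear brB" "bilinear \<rho>1" "bilinear \<psi>" "bilinear br" and skew: "skew_symmetric br"
    using assms(2,3,4,13) unfolding lie_algebra_def lie_representation_def Z2_def by blast+
  note bilinears = \<omega>a(1) bil(1-3) assms(5-8,10,12)
  note expand = extension_bracket_expand[OF bil(4) skew assms(14-19)]

  define D1 where "D1 a f b = dual_apply (\<rho>1 a f) b + dual_apply f (\<pi>1 a b)" for a f b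
  define D2 where "D2 b1 b2 b3 = dual_apply (\<Phi>2 b1 b2) b3 + dual_apply (\<Phi>2 b2 b3) b1
    + dual_apply (\<Phi>2 b3 b1) b2" for b1 b2 b3
  define D3 where "D3 a b1 b2 = dual_apply (\<Omega> b1 a) b2 - dual_apply (\<Omega> b2 a) b1
    - \<omega>a a (\<Phi>1 b1 b2)" for a b1 b2
  define D4 where "D4 f b1 b2 = dual_apply f (brB b1 b2)
    - (dual_apply (\<rho>2 b2 f) b1 - dual_apply (\<rho>2 b1 f) b2)" for f b1 b2
  define D5 where "D5 a1 a2 b = dual_apply (\<psi> a1 a2) b
    - (\<omega>a (\<pi>2 b a1) a2 + \<omega>a a1 (\<pi>2 b a2))" for a1 a2 b
  note D_defs = D1_def D2_def D3_def D4_def D5_def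

  define J where "J x y z = ?\<omega> (br x y) z + ?\<omega> (br y z) x + ?\<omega> (br z x) y" for x y z
  \<comment> \<open>Three arguments of distinct types can be placed in six ways; as \<open>J\<close> is alternating, the
    signs of the six \<open>D1\<close> terms are those of the permutations. The components \<open>D3\<close>,
    \<open>D4\<close>, \<open>D5\<close> are alternating in their two arguments of the same type, and \<open>D2\<close> in all three, so
    cyclic sums of the former and a single \<open>D2\<close> cover all placements.\<close>
  have J_eq: "J (b1, a1, f1) (b2, a2, f2) (b3, a3, f3) =
      - D1 a2 f3 b1 - D1 a3 f1 b2 - D1 a1 f2 b3 + D1 a3 f2 b1 + D1 a1 f3 b2 + D1 a2 f1 b3
      - D2 b1 b2 b3
      + D3 a3 b1 b2 + D3 a1 b2 b3 + D3 a2 b3 b1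
      + D4 f3 b1 b2 + D4 f1 b2 b3 + D4 f2 b3 b1
      - D5 a1 a2 b3 - D5 a2 a3 b1 - D5 a3 a1 b2"
    for b1 a1 f1 b2 a2 f2 b3 a3 f3
    using closed[of a1 a2 a3]
    unfolding J_def expand D_defs extension_form_def
    by (simp only: prod.case dual_apply_simps bilinear_ladd[OF \<omega>a(1)] bilinear_lsub[OF \<omega>a(1)]
      flip[of "\<Phi>1 _ _"] flip[of "\<pi>2 _ _"])
  \<comment> \<open>Bilinearity kills every component with a zero argument, so only one term of the identity
    survives on a triple of homogeneous elements.\<close>
  note D_zero = D_defs dual_apply_simps bilinears[THEN bilinear_lzero] bilinears[THEN bilinear_rzero]
  have comps: "D1 a f b = J (0, a, 0) (b, 0, 0) (0, 0, f)"
    "D2 b1 b2 b3 = - J (b1, 0, 0) (b2, 0, 0) (b3, 0, 0)"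
    "D3 a b1 b2 = J (b1, 0, 0) (b2, 0, 0) (0, a, 0)"
    "D4 f b1 b2 = J (b1, 0, 0) (b2, 0, 0) (0, 0, f)"
    "D5 a1 a2 b = - J (0, a1, 0) (0, a2, 0) (b, 0, 0)" for a f b b1 b2 b3 a1 a2
    unfolding J_eq by (simp_all add: D_zero)
  have J_zero_iff: "(\<forall>x y z. J x y z = 0) \<longleftrightarrow>
      (\<forall>a f b. D1 a f b = 0) \<and> (\<forall>b1 b2 b3. D2 b1 b2 b3 = 0) \<and> (\<forall>a b1 b2. D3 a b1 b2 = 0)
      \<and> (\<forall>f b1 b2. D4 f b1 b2 = 0) \<and> (\<forall>a1 a2 b. D5 a1 a2 b = 0)" (is "?L \<longleftrightarrow> ?R")
  proof
    show "?L \<Longrightarrow> ?R"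
      unfolding comps by simp
    show "?R \<Longrightarrow> ?L"
      by (simp add: split_paired_all J_eq)
  qed
  have form: "bilinear ?\<omega>" "skew_symmetric ?\<omega>" "nondegenerate ?\<omega>"
    using bilinear_extension_form[OF \<omega>a(1)] skew_symmetric_extension_form[OF \<omega>a(2)]
      nondegenerate_extension_form[OF \<omega>a(1,3)] by auto
  then have "two_cocycle br ?\<omega> \<longleftrightarrow> (\<forall>x y z. J x y z = 0)"
    unfolding two_cocycle_def J_def by blast
  then show ?thesis
    unfolding J_zero_iff D_defs
    by (simp only: form eq_neg_iff_add_eq_0 right_minus_eq simp_thms)
qed

end
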